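(* For weighted house allocation instances, the problem of finding an allocation of minimum total envy among all egalitarian welfare maximizing allocations is as hard as the problem of finding a complete allocation of minimum total envy (among all complete allocations); that is, the latter problem reduces in polynomial time to the former.
   Context: A house allocation instance $\langle N,H,V\rangle$ consists of a finite set $N$ of $n$ agents, a finite set $H$ of $m$ houses, and for each agent $i\in N$ a valuation $v_i:H\to\mathbb{R}_{\ge 0}$, with the convention $v_i(\emptyset)=0$. A weighted instance allows arbitrary non-negative values. An allocation $A$ assigns to each agent $i$ either one house $A(i)\in H$ or nothing ($A(i)=\emptyset$), with each house assigned to at most one agent; an agent may be assigned a house it values at zero, and houses may remain unassigned. An allocation is complete if every agent is assigned a house (when $m\ge n$), or every house is assigned to an agent (when $m<n$). The total envy of $A$ is $\sum_{i\in N}\sum_{j\in N}\max\{v_i(A(j))-v_i(A(i)),0\}$. Egalitarian welfare maximization: if some allocation gives every agent positive value, an allocation is egalitarian welfare maximizing if it maximizes $\min_{i\in N}v_i(A(i))$. Otherwise, let $k$ be the largest number of agents that can simultaneously receive a positive value in an allocation; an allocation $A$ is egalitarian welfare maximizing if it maximizes the $k$-egalitarian welfare, i.e. the value $\min_{i\in S}v_i(A(i))$ over allocations $A$ and sets $S\subseteq N$ with $|S|=k$. *)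

theory Defs
  imports Complex_Main "HOL-Computational_Algebra.Polynomial"
begin

section \<open>House allocation\<close>

text \<open>An allocation is a partial map from agents to houses; \<^term>\<open>None\<close> plays the role of
  the empty bundle.\<close>

definition allocation :: "'a set \<Rightarrow> 'h set \<Rightarrow> ('a \<rightharpoonup> 'h) \<Rightarrow> bool" where
  "allocation N H A \<longleftrightarrow> dom A \<subseteq> N \<and> ran A \<subseteq> H \<and> inj_on A (dom A)"

definition complete_allocation :: "'a set \<Rightarrow> 'h set \<Rightarrow> ('a \<rightharpoonup> 'h) \<Rightarrow> bool" where
  "complete_allocation N H A \<longleftrightarrow>
     allocation N H A \<and> (if card H \<ge> card N then dom A = N else ran A = H)"

definition utility :: "('a \<Rightarrow> 'h \<Rightarrow> real) \<Rightarrow> 'a \<Rightarrow> 'h option \<Rightarrow> real" where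
  "utility v i b = (case b of None \<Rightarrow> 0 | Some h \<Rightarrow> v i h)"

definition total_envy :: "'a set \<Rightarrow> ('a \<Rightarrow> 'h \<Rightarrow> real) \<Rightarrow> ('a \<rightharpoonup> 'h) \<Rightarrow> real" where
  "total_envy N v A = (\<Sum>i\<in>N. \<Sum>j\<in>N. max (utility v i (A j) - utility v i (A i)) 0)"

definition max_positive_agents :: "'a set \<Rightarrow> 'h set \<Rightarrow> ('a \<Rightarrow> 'h \<Rightarrow> real) \<Rightarrow> nat" where
  "max_positive_agents N H v =
     Max {card {i \<in> N. utility v i (A i) > 0} | A. allocation N H A}"

text \<open>If \<^term>\<open>S = {}\<close> the value below is the unspecified constant \<^term>\<open>Min {} :: real\<close>.
  Minima over the empty set are then only compared with each other, so every allocation is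
  egalitarian welfare maximizing when there are no agents or when no agent can receive a
  positive value.\<close>

definition egal_value :: "('a \<Rightarrow> 'h \<Rightarrow> real) \<Rightarrow> 'a set \<Rightarrow> ('a \<rightharpoonup> 'h) \<Rightarrow> real" where
  "egal_value v S A = Min ((\<lambda>i. utility v i (A i)) ` S)"

definition egal_maximizing ::
    "'a set \<Rightarrow> 'h set \<Rightarrow> ('a \<Rightarrow> 'h \<Rightarrow> real) \<Rightarrow> ('a \<rightharpoonup> 'h) \<Rightarrow> bool" where
  "egal_maximizing N H v A \<longleftrightarrow> allocation N H A \<and>
     (if \<exists>B. allocation N H B \<and> (\<forall>i\<in>N. utility v i (B i) > 0)
      then \<forall>B. allocation N H B \<longrightarrow> egal_value v N B \<le> egal_value v N A
      else let k = max_positive_agents N H v in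
        \<exists>S. S \<subseteq> N \<and> card S = k \<and>
          (\<forall>B T. allocation N H B \<and> T \<subseteq> N \<and> card T = k \<longrightarrow>
             egal_value v T B \<le> egal_value v S A))"


section \<open>Polynomial-time computation on multitape Turing machines\<close>

text \<open>Strings and tapes use one fixed finite alphabet; \<^term>\<open>Blank\<close> occurs in no encoding
  and \<^term>\<open>Sep\<close> only separates the components of a pair.\<close>

datatype symbol = Blank | Zero | One | Slash | Comma | Semicolon | Sep

datatype move = Move_Left | Stay | Move_Right

type_synonym tape = "(int \<Rightarrow> symbol) \<times> int"

text \<open>The non-halting states are \<open>0, \<dots>, num_states M - 1\<close>, with start state \<open>0\<close>; the halting
  state is \<open>num_states M\<close>.  The transition function maps a state and the scanned symbols to
  the next state and, for each tape, the symbol to be written and the head movement.\<close>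

record machine =
  num_tapes :: nat
  num_states :: nat
  transition :: "nat \<Rightarrow> symbol list \<Rightarrow> nat \<times> (symbol \<times> move) list"

definition turing_machine :: "machine \<Rightarrow> bool" where
  "turing_machine M \<longleftrightarrow> num_tapes M \<ge> 2 \<and>
     (\<forall>q < num_states M. \<forall>rs. length rs = num_tapes M \<longrightarrow>
        fst (transition M q rs) \<le> num_states M \<and> length (snd (transition M q rs)) = num_tapes M)"

fun scanned :: "tape \<Rightarrow> symbol" where
  "scanned (c, p) = c p"

fun act :: "symbol \<times> move \<Rightarrow> tape \<Rightarrow> tape" where
  "act (s, d) (c, p) =
     (c(p := s), case d of Move_Left \<Rightarrow> p - 1 | Stay \<Rightarrow> p | Move_Right \<Rightarrow> p + 1)"

fun step :: "machine \<Rightarrow> nat \<times> tape list \<Rightarrow> nat \<times> tape list" where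
  "step M (q, ts) =
     (if q < num_states M
      then (let (q', as) = transition M q (map scanned ts) in (q', map2 act as ts))
      else (q, ts))"

definition contents :: "symbol list \<Rightarrow> int \<Rightarrow> symbol" where
  "contents x p = (if 0 \<le> p \<and> p < int (length x) then x ! nat p else Blank)"

definition start_config :: "machine \<Rightarrow> symbol list \<Rightarrow> nat \<times> tape list" where
  "start_config M x = (0, (contents x, 0) # replicate (num_tapes M - 1) (contents [], 0))"

text \<open>Input is on tape \<open>0\<close> and output on tape \<open>1\<close>.  Halting configurations are fixed points of
  \<^const>\<open>step\<close>, so running for exactly \<open>t\<close> steps means halting within \<open>t\<close> steps.\<close>

definition computes_within :: "machine \<Rightarrow> symbol list \<Rightarrow> symbol list \<Rightarrow> nat \<Rightarrow> bool" where
  "computes_within M x y t \<longleftrightarrow>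
     (let (q, ts) = (step M ^^ t) (start_config M x)
      in q = num_states M \<and> fst (ts ! 1) = contents y)"

text \<open>Some machine turns the string \<open>inp x\<close> into the string \<open>out x\<close>, for every \<open>x \<in> D\<close>, in time
  polynomial in the length of \<open>inp x\<close>.\<close>

definition polytime :: "'x set \<Rightarrow> ('x \<Rightarrow> symbol list) \<Rightarrow> ('x \<Rightarrow> symbol list) \<Rightarrow> bool" where
  "polytime D inp out \<longleftrightarrow>
     (\<exists>M (p :: nat poly). turing_machine M \<and>
        (\<forall>x\<in>D. computes_within M (inp x) (out x) (poly p (length (inp x)))))"


section \<open>Search problems and reductions\<close>

record ('i, 's) search_problem =
  inputs :: "'i set"
  solutions :: "'i \<Rightarrow> 's set"
  encode_input :: "'i \<Rightarrow> symbol list"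
  encode_solution :: "'i \<Rightarrow> 's \<Rightarrow> symbol list"

text \<open>Many-one (Levin) reduction: \<open>f\<close> translates inputs of \<open>P\<close> into inputs of \<open>Q\<close>, and \<open>g\<close> turns
  any solution of the translated input into a solution of the original one.\<close>

definition poly_reducible ::
    "('i, 's) search_problem \<Rightarrow> ('j, 't) search_problem \<Rightarrow> bool" where
  "poly_reducible P Q \<longleftrightarrow>
     (\<exists>f g.
        (\<forall>I \<in> inputs P. f I \<in> inputs Q) \<and>
        (\<forall>I \<in> inputs P. solutions P I \<noteq> {} \<longrightarrow> solutions Q (f I) \<noteq> {}) \<and>
        (\<forall>I \<in> inputs P. \<forall>S \<in> solutions Q (f I). g I S \<in> solutions P I) \<and>
        polytime (inputs P) (encode_input P) (\<lambda>I. encode_input Q (f I)) \<and>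
        polytime {(I, S). I \<in> inputs P \<and> S \<in> solutions Q (f I)}
          (\<lambda>(I, S). encode_input P I @ [Sep] @ encode_solution Q (f I) S)
          (\<lambda>(I, S). encode_solution P I (g I S)))"


section \<open>The two optimization problems\<close>

text \<open>An input \<open>(m, V)\<close> has agents \<open>0, \<dots>, length V - 1\<close> and houses \<open>0, \<dots>, m - 1\<close>; entry \<open>h\<close> of
  row \<open>i\<close> of \<open>V\<close> is the value of house \<open>h\<close> to agent \<open>i\<close>.  Values are rational so that inputs are
  finite objects.\<close>

type_synonym instance_data = "nat \<times> rat list list"

definition weighted_instances :: "instance_data set" where
  "weighted_instances = {(m, V). \<forall>row \<in> set V. length row = m \<and> (\<forall>x \<in> set row. x \<ge> 0)}"

definition agents :: "instance_data \<Rightarrow> nat set" where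
  "agents I = {..<length (snd I)}"

definition houses :: "instance_data \<Rightarrow> nat set" where
  "houses I = {..<fst I}"

definition valuation :: "instance_data \<Rightarrow> nat \<Rightarrow> nat \<Rightarrow> real" where
  "valuation I i h = real_of_rat (snd I ! i ! h)"

text \<open>Binary notation, least significant digit first, without leading zeros (so \<open>0\<close> is the empty
  word).\<close>

fun binary :: "nat \<Rightarrow> symbol list" where
  "binary n = (if n = 0 then [] else (if odd n then One else Zero) # binary (n div 2))"

declare binary.simps [simp del]

definition encode_rat :: "rat \<Rightarrow> symbol list" where
  "encode_rat x = (case quotient_of x of (a, b) \<Rightarrow> binary (nat a) @ [Slash] @ binary (nat b))"

text \<open>The houses are listed in unary, like the agents (one row each).\<close>

definition encode_instance :: "instance_data \<Rightarrow> symbol list" where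
  "encode_instance I = replicate (fst I) One @ [Semicolon] @
     concat (map (\<lambda>row. concat (map (\<lambda>x. encode_rat x @ [Comma]) row) @ [Semicolon]) (snd I))"

definition encode_allocation :: "instance_data \<Rightarrow> (nat \<rightharpoonup> nat) \<Rightarrow> symbol list" where
  "encode_allocation I A = concat (map
     (\<lambda>i. binary (case A i of None \<Rightarrow> 0 | Some h \<Rightarrow> Suc h) @ [Comma]) [0..<length (snd I)])"

definition min_envy_complete :: "(instance_data, nat \<rightharpoonup> nat) search_problem" where
  "min_envy_complete = \<lparr>
     inputs = weighted_instances,
     solutions = (\<lambda>I. {A. is_arg_min (total_envy (agents I) (valuation I))
        (complete_allocation (agents I) (houses I)) A}),
     encode_input = encode_instance,
     encode_solution = encode_allocation \<rparr>"

definition min_envy_egal_maximizing :: "(instance_data, nat \<rightharpoonup> nat) search_problem" where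
  "min_envy_egal_maximizing = \<lparr>
     inputs = weighted_instances,
     solutions = (\<lambda>I. {A. is_arg_min (total_envy (agents I) (valuation I))
        (egal_maximizing (agents I) (houses I) (valuation I)) A}),
     encode_input = encode_instance,
     encode_solution = encode_allocation \<rparr>"

end

(* Add 1 to all values, and add a new agent (agent 0) and a new house (house m), where the new agent
   values the new house at 1 and all other values of the two are 0.  Every utility is then 0 or at
   least 1, and the new agent never exceeds 1.  Hence the egalitarian welfare maximizing allocations
   are those that give the new house to the new agent and restrict to a complete allocation, because
   both conditions say that min(m, n) + 1 agents have positive value.  Adding a constant to the values
   does not affect envy between agents with houses, and increases the envy of an agent without a house
   towards one with a house by 1, so that total envy changes by a constant.

   The old agents and houses keep their order, the new agent is first and the new house last: this way
   an encoded allocation is translated back by dropping its first entry.  The only arithmetic needed is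
   a/b + 1 = (a + b)/b, which is again in lowest terms. *)

theory Submission
  imports Defs
begin

section \<open>While programs for Turing machines\<close>

datatype prog =
    Act "symbol list \<Rightarrow> (symbol \<times> move) list"
  | Seq prog prog  (infixr \<open>;;\<close> 60)
  | While "symbol list \<Rightarrow> bool" prog

text \<open>The number counts steps of the compiled machine: an action and every test of a loop cost
  one step, sequencing costs nothing. Case distinctions on the scanned symbols are made inside
  \<open>Act\<close>.\<close>

inductive exec :: "prog \<Rightarrow> tape list \<Rightarrow> nat \<Rightarrow> tape list \<Rightarrow> bool" where
  exec_Act: "exec (Act f) ts 1 (map2 act (f (map scanned ts)) ts)"
| exec_Seq: "exec P ts k ts' \<Longrightarrow> exec Q ts' l ts'' \<Longrightarrow> exec (P ;; Q) ts (k + l) ts''"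
| exec_While_False: "\<not> b (map scanned ts) \<Longrightarrow> exec (While b P) ts 1 ts"
| exec_While_True: "b (map scanned ts) \<Longrightarrow> exec P ts k ts' \<Longrightarrow> exec (While b P) ts' l ts''
    \<Longrightarrow> exec (While b P) ts (1 + k + l) ts''"

fun num_nodes :: "prog \<Rightarrow> nat" where
  "num_nodes (Act f) = 1"
| "num_nodes (P ;; Q) = num_nodes P + num_nodes Q"
| "num_nodes (While b P) = 1 + num_nodes P"

text \<open>The code of \<open>P\<close> occupies the states from \<open>s\<close> (its entry) to \<open>s + num_nodes P - 1\<close> and leaves
  to the state \<open>e\<close>.\<close>

fun code_of :: "prog \<Rightarrow> nat \<Rightarrow> nat \<Rightarrow> nat \<Rightarrow> symbol list \<Rightarrow> nat \<times> (symbol \<times> move) list" where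
  "code_of (Act f) s e q rs = (e, f rs)"
| "code_of (P ;; Q) s e q rs =
     (if q < s + num_nodes P then code_of P s (s + num_nodes P) q rs
      else code_of Q (s + num_nodes P) e q rs)"
| "code_of (While b P) s e q rs =
     (if q = s then (if b rs then s + 1 else e, map (\<lambda>x. (x, Stay)) rs)
      else code_of P (s + 1) s q rs)"

fun well_formed :: "nat \<Rightarrow> prog \<Rightarrow> bool" where
  "well_formed n (Act f) \<longleftrightarrow> (\<forall>rs. length rs = n \<longrightarrow> length (f rs) = n)"
| "well_formed n (P ;; Q) \<longleftrightarrow> well_formed n P \<and> well_formed n Q"
| "well_formed n (While b P) \<longleftrightarrow> well_formed n P"

definition machine_of :: "nat \<Rightarrow> prog \<Rightarrow> machine" where
  "machine_of n P = \<lparr>num_tapes = n, num_states = num_nodes P,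
     transition = code_of P 0 (num_nodes P)\<rparr>"

lemma act_scanned_Stay [simp]: "act (scanned t, Stay) t = t"
  by (cases t) simp

text \<open>The test of a loop is compiled to a step that writes the scanned symbols back and moves
  no head.\<close>

lemma map2_act_Stay: "map2 act (map (\<lambda>x. (x, Stay)) (map scanned ts)) ts = ts"
  by (induction ts) auto

text \<open>Code placed anywhere in \<open>M\<close>, with any exit \<open>e\<close>, is what the
  induction needs: the first part of a sequence exits to the second, the body of a loop to the test.
  The last assumption keeps the states of the code from being the halting one; \<open>e\<close>
  itself may be it.\<close>

lemma exec_code_of:
  assumes "exec P ts k ts'"
    and "\<And>q rs. s \<le> q \<Longrightarrow> q < s + num_nodes P \<Longrightarrow> transition M q rs = code_of P s e q rs"
    and "s + num_nodes P \<le> num_states M"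
  shows "(step M ^^ k) (s, ts) = (e, ts')"
  using assms
proof (induction arbitrary: s e rule: exec.induct)
  case (exec_Act f ts)
  then show ?case by simp
next
  case (exec_Seq P ts k ts' Q l ts'')
  have "(step M ^^ k) (s, ts) = (s + num_nodes P, ts')"
    using exec_Seq.prems by (intro exec_Seq.IH) auto
  moreover have "(step M ^^ l) (s + num_nodes P, ts') = (e, ts'')"
    using exec_Seq.prems by (intro exec_Seq.IH) auto
  ultimately show ?case
    by (subst add.commute) (simp add: funpow_add)
next
  case (exec_While_False b ts P)
  then show ?case by (simp add: map2_act_Stay del: map_map)
next
  case (exec_While_True b ts P k ts' l ts'')
  have "step M (s, ts) = (s + 1, ts)"
    using exec_While_True.hyps exec_While_True.prems by (simp add: map2_act_Stay del: map_map)
  moreover have "(step M ^^ k) (s + 1, ts) = (s, ts')"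
    using exec_While_True.prems by (intro exec_While_True.IH) auto
  moreover have "(step M ^^ l) (s, ts') = (e, ts'')"
    using exec_While_True.prems by (intro exec_While_True.IH) auto
  ultimately have "(step M ^^ l) ((step M ^^ k) ((step M ^^ 1) (s, ts))) = (e, ts'')"
    by (simp del: step.simps)
  then have "(step M ^^ (l + (k + 1))) (s, ts) = (e, ts'')"
    by (simp only: funpow_add comp_apply)
  then show ?case by (simp add: ac_simps)
qed

text \<open>The maximum accounts for exits in both directions: past the end of the code or, for the
  body of a loop, back to its test.\<close>

lemma code_of_bounds:
  assumes "well_formed n P" "length rs = n" "s \<le> q" "q < s + num_nodes P"
  shows "fst (code_of P s e q rs) \<le> max e (s + num_nodes P) \<and> length (snd (code_of P s e q rs)) = n"
  using assms
proof (induction P arbitrary: s e q)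
  case (Seq P Q)
  show ?case
  proof (cases "q < s + num_nodes P")
    case True
    with Seq.IH(1)[of s q "s + num_nodes P"] Seq.prems show ?thesis by auto
  next
    case False
    with Seq.IH(2)[of "s + num_nodes P" q e] Seq.prems show ?thesis by (auto simp: ac_simps)
  qed
next
  case (While b P)
  show ?case
  proof (cases "q = s")
    case False
    with While.IH[of "s + 1" q s] While.prems show ?thesis by auto
  qed (use While.prems in auto)
qed auto

lemma turing_machine_machine_of:
  assumes "n \<ge> 2" "well_formed n P"
  shows "turing_machine (machine_of n P)"
  using assms code_of_bounds[of n P _ 0 _ "num_nodes P"]
  by (auto simp: turing_machine_def machine_of_def)

section \<open>Execution within a time bound\<close>

definition runs :: "prog \<Rightarrow> tape list \<Rightarrow> nat \<Rightarrow> tape list \<Rightarrow> bool" where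
  "runs P ts k ts' \<longleftrightarrow> (\<exists>l\<le>k. exec P ts l ts')"

lemma runs_mono: "runs P ts k ts' \<Longrightarrow> k \<le> l \<Longrightarrow> runs P ts l ts'"
  by (auto simp: runs_def intro: le_trans)

text \<open>Applied first, this rule leaves the final tapes and the time open; a chain of rules
  along the program computes both, and the last two premises compare them with the claim.\<close>

lemma runs_conv: "runs P ts k us \<Longrightarrow> us = ts' \<Longrightarrow> k \<le> l \<Longrightarrow> runs P ts l ts'"
  by (auto simp: runs_def intro: le_trans)

lemma runs_Act: "map2 act (f (map scanned ts)) ts = ts' \<Longrightarrow> runs (Act f) ts 1 ts'"
  unfolding runs_def using exec_Act by blast

lemma runs_Seq: "runs P ts k ts' \<Longrightarrow> runs Q ts' l ts'' \<Longrightarrow> runs (P ;; Q) ts (k + l) ts''"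
  unfolding runs_def using exec_Seq add_mono by meson

lemma runs_While_False: "\<not> b (map scanned ts) \<Longrightarrow> runs (While b P) ts 1 ts"
  unfolding runs_def using exec_While_False by blast

lemma runs_While_True:
  assumes "b (map scanned ts)" "runs P ts k ts'" "runs (While b P) ts' l ts''"
  shows "runs (While b P) ts (1 + k + l) ts''"
proof -
  obtain k' l' where "k' \<le> k" "exec P ts k' ts'" "l' \<le> l" "exec (While b P) ts' l' ts''"
    using assms by (auto simp: runs_def)
  with exec_While_True[where b = b, OF assms(1)] show ?thesis
    unfolding runs_def by (intro exI[of _ "1 + k' + l'"]) auto
qed

lemma runs_While_stop: "\<not> b (map scanned ts) \<Longrightarrow> 1 \<le> k \<Longrightarrow> runs (While b P) ts k ts"
  by (rule runs_mono[OF runs_While_False])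

text \<open>A round costs one step for the test and one for the action, whence the factor 2 in the
  bounds for simple loops.\<close>

lemma runs_While_Act:
  assumes "b (map scanned ts)" "runs (While b (Act f)) (map2 act (f (map scanned ts)) ts) k ts'"
    and "k + 2 \<le> l"
  shows "runs (While b (Act f)) ts l ts'"
proof -
  have "runs (While b (Act f)) ts (1 + 1 + k) ts'"
    using assms(1) runs_Act[OF refl] assms(2) by (rule runs_While_True)
  then show ?thesis using assms(3) by (simp add: runs_mono)
qed

section \<open>Tapes split at the head\<close>

text \<open>A zipper: \<open>l\<close> lists the cells before the head, nearest first, and
  \<open>r\<close> those from the scanned cell on. The list \<open>rev l @ r\<close> begins at
  position 0, and all other cells are blank.\<close>

definition tape :: "symbol list \<Rightarrow> symbol list \<Rightarrow> tape" where
  "tape l r = (contents (rev l @ r), int (length l))"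

lemma contents_append_Blank: "contents (x @ [Blank]) = contents x"
  by (rule ext) (auto simp: contents_def nth_append)

lemma contents_upd: "(contents (x @ a # y)) (int (length x) := b) = contents (x @ b # y)"
  by (rule ext) (auto simp: contents_def nth_append nth_Cons split: nat.splits)

text \<open>Cells beyond the list are blank anyway. These two shapes arise when a blank is written
  at the right end and the head stays or moves left.\<close>

lemma tape_Blank [simp]: "tape l [Blank] = tape l []" "tape l [x, Blank] = tape l [x]"
  using contents_append_Blank[of "rev l"] contents_append_Blank[of "rev l @ [x]"]
  by (simp_all add: tape_def)

lemma scanned_tape [simp]:
  "scanned (tape l []) = Blank"
  "scanned (tape l (x # r)) = x"
  by (auto simp: tape_def contents_def nth_append)

text \<open>The rule for \<open>Move_Left\<close> requires a cell before the head. On tape 2, a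
  blank guard cell stops the leftward loops in time.\<close>

lemma act_tape_Cons:
  "act (s, Move_Right) (tape l (x # r)) = tape (s # l) r"
  "act (s, Stay) (tape l (x # r)) = tape l (s # r)"
  "act (s, Move_Left) (tape (y # l) (x # r)) = tape l (y # s # r)"
  using contents_upd[of "rev l" x r s] contents_upd[of "rev l @ [y]" x r s]
  by (simp_all add: tape_def)

lemma act_tape_Nil:
  "act (s, Move_Right) (tape l []) = tape (s # l) []"
  "act (s, Stay) (tape l []) = tape l [s]"
  "act (s, Move_Left) (tape (y # l) []) = tape l [y, s]"
  using act_tape_Cons[where x = Blank and r = "[]"] by simp_all

lemmas act_tape [simp] = act_tape_Cons act_tape_Nil

lemma fst_tape: "fst (tape (rev y) []) = contents y"
  by (simp add: tape_def)

lemma polytimeI: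
  fixes p :: "nat poly"
  assumes "n \<ge> 2" "well_formed n P"
    and "\<And>x. x \<in> D \<Longrightarrow> \<exists>ts. runs P (tape [] (inp x) # replicate (n - 1) (tape [] []))
           (poly p (length (inp x))) ts \<and> ts ! 1 = tape (rev (out x)) []"
  shows "polytime D inp out"
  unfolding polytime_def
proof (intro exI conjI ballI)
  let ?M = "machine_of n P"
  show "turing_machine ?M" using assms(1,2) by (rule turing_machine_machine_of)
  fix x assume "x \<in> D"
  then obtain ts k where k: "k \<le> poly p (length (inp x))" and ts: "ts ! 1 = tape (rev (out x)) []"
    and "exec P (tape [] (inp x) # replicate (n - 1) (tape [] [])) k ts"
    using assms(3) unfolding runs_def by blast
  then have run: "(step ?M ^^ k) (start_config ?M (inp x)) = (num_nodes P, ts)"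
    using exec_code_of[where s = 0 and M = ?M and e = "num_nodes P"]
    by (simp add: machine_of_def start_config_def tape_def)
  \<comment> \<open>A halted machine repeats its configuration, which fills the time up to the exact
    value of the polynomial.\<close>
  have halt: "(step ?M ^^ j) (num_nodes P, ts) = (num_nodes P, ts)" for j
    by (induction j) (auto simp: machine_of_def)
  have "(step ?M ^^ poly p (length (inp x))) (start_config ?M (inp x)) = (num_nodes P, ts)"
    using funpow_add[of "poly p (length (inp x)) - k" k "step ?M"] k run halt by simp
  then show "computes_within ?M (inp x) (out x) (poly p (length (inp x)))"
    using ts by (simp add: computes_within_def machine_of_def fst_tape)
qed

section \<open>The machines of the reduction\<close>

lemma set_binary: "set (binary n) \<subseteq> {Zero, One}"
proof (induction n rule: binary.induct)
  case (1 n)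
  then show ?case by (subst binary.simps) auto
qed

lemma notin_binary [simp]:
  "Blank \<notin> set (binary n)" "Slash \<notin> set (binary n)" "Comma \<notin> set (binary n)"
  "Semicolon \<notin> set (binary n)" "Sep \<notin> set (binary n)"
  using set_binary[of n] by auto

section \<open>Dropping the first entry of an encoded allocation\<close>

definition skip_past :: "symbol \<Rightarrow> prog" where
  "skip_past s =
     While (\<lambda>rs. rs ! 0 \<noteq> s) (Act (\<lambda>rs. [(rs ! 0, Move_Right), (rs ! 1, Stay)])) ;;
     Act (\<lambda>rs. [(rs ! 0, Move_Right), (rs ! 1, Stay)])"

text \<open>The instance up to \<open>Sep\<close> and the entry of the new agent up to its comma are
  skipped. Old houses keep their numbers, so the remaining entries are copied verbatim.\<close>

definition allocation_prog :: prog where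
  "allocation_prog = skip_past Sep ;; skip_past Comma ;;
     While (\<lambda>rs. rs ! 0 \<noteq> Blank) (Act (\<lambda>rs. [(rs ! 0, Move_Right), (rs ! 0, Move_Right)]))"

lemma runs_skip_past:
  assumes "s \<notin> set xs"
  shows "runs (skip_past s) [tape l (xs @ s # r), t] (2 * length xs + 2)
    [tape (s # rev xs @ l) r, t]"
proof -
  have loop: "runs (While (\<lambda>rs. rs ! 0 \<noteq> s) (Act (\<lambda>rs. [(rs ! 0, Move_Right), (rs ! 1, Stay)])))
     [tape l (xs @ s # r), t] (2 * length xs + 1) [tape (rev xs @ l) (s # r), t]"
    using assms
  proof (induction xs arbitrary: l)
    case Nil
    then show ?case by (simp add: runs_While_stop)
  next
    case (Cons x xs)
    then show ?case
      by - (rule runs_While_Act[where k = "2 * length xs + 1"], auto)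
  qed
  show ?thesis
    unfolding skip_past_def
    by (rule runs_conv, rule runs_Seq, rule loop, rule runs_Act, simp, simp, simp)
qed

lemma runs_copy_rest:
  assumes "Blank \<notin> set xs"
  shows "runs (While (\<lambda>rs. rs ! 0 \<noteq> Blank) (Act (\<lambda>rs. [(rs ! 0, Move_Right), (rs ! 0, Move_Right)])))
    [tape l xs, tape k []] (2 * length xs + 1) [tape (rev xs @ l) [], tape (rev xs @ k) []]"
  using assms
proof (induction xs arbitrary: l k)
  case Nil
  then show ?case by (simp add: runs_While_stop)
next
  case (Cons x xs)
  then show ?case
    by - (rule runs_While_Act[where k = "2 * length xs + 1"], auto)
qed

lemma runs_allocation_prog:
  assumes "Sep \<notin> set xs" "Comma \<notin> set ys" "Blank \<notin> set zs"
  shows "runs allocation_prog [tape [] (xs @ Sep # ys @ Comma # zs), tape [] []]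
    (5 + 2 * length (xs @ Sep # ys @ Comma # zs))
    [tape (rev (xs @ Sep # ys @ Comma # zs)) [], tape (rev zs) []]"
proof -
  have copy: "runs (While (\<lambda>rs. rs ! 0 \<noteq> Blank) (Act (\<lambda>rs. [(rs ! 0, Move_Right), (rs ! 0, Move_Right)])))
      [tape l zs, tape [] []] (2 * length zs + 1) [tape (rev zs @ l) [], tape (rev zs) []]" for l
    using runs_copy_rest[OF assms(3), of l "[]"] by simp
  show ?thesis
    unfolding allocation_prog_def
    by (rule runs_conv, rule runs_Seq, rule runs_skip_past, rule assms, rule runs_Seq,
        rule runs_skip_past, rule assms, rule copy, simp, simp)
qed

section \<open>Programs that extend an instance\<close>

definition emit :: "symbol \<Rightarrow> prog" where
  "emit s = Act (\<lambda>rs. [(rs ! 0, Stay), (s, Move_Right), (rs ! 2, Stay), (rs ! 3, Stay)])"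

lemma runs_emit: "runs (emit s) [t0, tape l [], t2, t3] 1 [t0, tape (s # l) [], t2, t3]"
  unfolding emit_def by (rule runs_Act) simp

text \<open>The carry is kept on tape \<open>3\<close>, with a blank for \<open>0\<close>.\<close>

definition add_digits :: "symbol list \<Rightarrow> (symbol \<times> move) list" where
  "add_digits rs =
     (let c = of_bool (rs ! 0 = One) + of_bool (rs ! 2 = One) + of_bool (rs ! 3 = One) :: nat
      in [(rs ! 0, if rs ! 0 = Comma then Stay else Move_Right),
          (if odd c then One else Zero, Move_Right),
          (Blank, if rs ! 2 = Blank then Stay else Move_Right),
          (if c \<ge> 2 then One else Blank, Stay)])"

text \<open>The denominator on tape 0 ends at a comma, the numerator on tape 2 at a blank. A head
  that reaches the end of its number stays there and supplies zero digits. Tape 2 is erased on the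
  way, ready for the next entry.\<close>

definition adder :: prog where
  "adder = While (\<lambda>rs. rs ! 0 \<noteq> Comma \<or> rs ! 2 \<noteq> Blank \<or> rs ! 3 \<noteq> Blank) (Act add_digits)"

text \<open>The denominator is read twice, first by the adder and then to be copied; in between, the
  head of tape 0 returns to the slash.\<close>

definition entry_prog :: prog where
  "entry_prog =
     While (\<lambda>rs. rs ! 0 \<noteq> Slash)
       (Act (\<lambda>rs. [(rs ! 0, Move_Right), (rs ! 1, Stay), (rs ! 0, Move_Right), (rs ! 3, Stay)])) ;;
     Act (\<lambda>rs. [(rs ! 0, Move_Right), (rs ! 1, Stay), (Blank, Move_Left), (rs ! 3, Stay)]) ;;
     While (\<lambda>rs. rs ! 2 \<noteq> Blank)
       (Act (\<lambda>rs. [(rs ! 0, Stay), (rs ! 1, Stay), (rs ! 2, Move_Left), (rs ! 3, Stay)])) ;;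
     Act (\<lambda>rs. [(rs ! 0, Stay), (rs ! 1, Stay), (rs ! 2, Move_Right), (rs ! 3, Stay)]) ;;
     adder ;;
     emit Slash ;;
     While (\<lambda>rs. rs ! 0 \<noteq> Slash)
       (Act (\<lambda>rs. [(rs ! 0, Move_Left), (rs ! 1, Stay), (rs ! 2, Stay), (rs ! 3, Stay)])) ;;
     Act (\<lambda>rs. [(rs ! 0, Move_Right), (rs ! 1, Stay), (rs ! 2, Stay), (rs ! 3, Stay)]) ;;
     While (\<lambda>rs. rs ! 0 \<noteq> Comma)
       (Act (\<lambda>rs. [(rs ! 0, Move_Right), (rs ! 0, Move_Right), (rs ! 2, Stay), (rs ! 3, Stay)])) ;;
     Act (\<lambda>rs. [(rs ! 0, Move_Right), (Comma, Move_Right), (rs ! 2, Stay), (rs ! 3, Stay)])"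

text \<open>The three symbols emitted after the entries form the value 0 of the new house: an empty
  numerator, a slash, the denominator 1 and a comma.\<close>

definition row_prog :: prog where
  "row_prog = While (\<lambda>rs. rs ! 0 \<noteq> Semicolon) entry_prog ;;
     emit Slash ;; emit One ;; emit Comma ;;
     Act (\<lambda>rs. [(rs ! 0, Move_Right), (Semicolon, Move_Right), (rs ! 2, Stay), (rs ! 3, Stay)])"

text \<open>Tape \<open>2\<close> starts with a blank cell, which marks its left end; the header is copied behind it,
  in order to write the row of the new agent.\<close>

definition instance_prog :: prog where
  "instance_prog =
     Act (\<lambda>rs. [(rs ! 0, Stay), (rs ! 1, Stay), (Blank, Move_Right), (rs ! 3, Stay)]) ;;
     While (\<lambda>rs. rs ! 0 = One)
       (Act (\<lambda>rs. [(rs ! 0, Move_Right), (One, Move_Right), (One, Move_Right), (rs ! 3, Stay)])) ;;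
     emit One ;;
     Act (\<lambda>rs. [(rs ! 0, Move_Right), (Semicolon, Move_Right), (Blank, Move_Left), (rs ! 3, Stay)]) ;;
     While (\<lambda>rs. rs ! 2 = One)
       (emit Slash ;; emit One ;;
        Act (\<lambda>rs. [(rs ! 0, Stay), (Comma, Move_Right), (Blank, Move_Left), (rs ! 3, Stay)])) ;;
     emit One ;; emit Slash ;; emit One ;; emit Comma ;;
     Act (\<lambda>rs. [(rs ! 0, Stay), (Semicolon, Move_Right), (Blank, Move_Right), (rs ! 3, Stay)]) ;;
     While (\<lambda>rs. rs ! 0 \<noteq> Blank) row_prog"

section \<open>Copying, rewinding and binary addition\<close>

lemma runs_read_numerator:
  assumes "Slash \<notin> set xs"
  shows "runs
    (While (\<lambda>rs. rs ! 0 \<noteq> Slash)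
       (Act (\<lambda>rs. [(rs ! 0, Move_Right), (rs ! 1, Stay), (rs ! 0, Move_Right), (rs ! 3, Stay)])))
    [tape l (xs @ Slash # r), t1, tape k [], t3] (2 * length xs + 1)
    [tape (rev xs @ l) (Slash # r), t1, tape (rev xs @ k) [], t3]"
  using assms
proof (induction xs arbitrary: l k)
  case Nil
  then show ?case by (simp add: runs_While_stop)
next
  case (Cons x xs)
  then show ?case
    by - (rule runs_While_Act[where k = "2 * length xs + 1"], auto)
qed

lemma runs_rewind:
  assumes "Blank \<notin> set (y # xs)"
  shows "runs
    (While (\<lambda>rs. rs ! 2 \<noteq> Blank)
       (Act (\<lambda>rs. [(rs ! 0, Stay), (rs ! 1, Stay), (rs ! 2, Move_Left), (rs ! 3, Stay)])))
    [t0, t1, tape (xs @ Blank # k) (y # r), t3] (2 * length xs + 3)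
    [t0, t1, tape k (Blank # rev xs @ y # r), t3]"
  using assms
proof (induction xs arbitrary: y r)
  case Nil
  then show ?case
    by - (rule runs_While_Act[where k = 1], auto simp: runs_While_stop)
next
  case (Cons x xs)
  then show ?case
    by - (rule runs_While_Act[where k = "2 * length xs + 3"], auto)
qed

text \<open>The left move before the loop is part of the statement, because it leads either to a
  digit or, for the empty word, straight to the guard cell.\<close>

lemma runs_rewind_from_end:
  assumes "Blank \<notin> set xs"
  shows "runs
    (While (\<lambda>rs. rs ! 2 \<noteq> Blank)
       (Act (\<lambda>rs. [(rs ! 0, Stay), (rs ! 1, Stay), (rs ! 2, Move_Left), (rs ! 3, Stay)])))
    [t0, t1, act (Blank, Move_Left) (tape (xs @ Blank # k) []), t3] (2 * length xs + 1)
    [t0, t1, tape k (Blank # rev xs), t3]"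
proof (cases xs)
  case Nil
  then show ?thesis by (simp add: runs_While_stop)
next
  case (Cons y ys)
  with assms runs_rewind[of y ys _ _ k "[]"] show ?thesis by (simp add: numeral_3_eq_3)
qed

text \<open>Splits off the lowest digit as a list that is empty for 0, so that summands of different
  lengths are treated alike.\<close>

lemma binary_rec: "binary n = (if n = 0 then [] else [if odd n then One else Zero]) @ binary (n div 2)"
proof (cases "n = 0")
  case True
  then show ?thesis by (simp add: binary.simps[of 0])
qed (simp add: binary.simps[of n])

lemma binary_0 [simp]: "binary 0 = []"
  by (simp add: binary.simps)

text \<open>Induction on the sum: one action writes its parity, and the halves of the two numbers
  together with the new carry add up to half of it.\<close>

lemma runs_adder:
  "runs adder
     [tape l (binary b @ Comma # r), tape w [], tape k (binary a), tape [] (if c then [One] else [])]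
     (2 * (length (binary a) + length (binary b) + of_bool c) + 1)
     [tape (rev (binary b) @ l) (Comma # r), tape (rev (binary (a + b + of_bool c)) @ w) [],
      tape (replicate (length (binary a)) Blank @ k) [], tape [] []]"
proof (induction "a + b + of_bool c" arbitrary: a b c l w k rule: less_induct)
  case less
  show ?case
  proof (cases "a + b + of_bool c = 0")
    case True
    then show ?thesis unfolding adder_def by (simp add: runs_While_stop)
  next
    case False
    let ?d = "of_bool (odd a) + of_bool (odd b) + of_bool c :: nat"
    let ?c = "2 \<le> ?d"
    have half: "(a + b + of_bool c) div 2 = a div 2 + b div 2 + of_bool ?c"
      by (cases "odd a"; cases "odd b"; cases c) (auto elim!: oddE evenE)
    have IH: "runs adder
       [tape l (binary (b div 2) @ Comma # r), tape w [], tape k (binary (a div 2)),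
        tape [] (if ?c then [One] else [])]
       (2 * (length (binary (a div 2)) + length (binary (b div 2)) + of_bool ?c) + 1)
       [tape (rev (binary (b div 2)) @ l) (Comma # r),
        tape (rev (binary ((a + b + of_bool c) div 2)) @ w) [],
        tape (replicate (length (binary (a div 2))) Blank @ k) [], tape [] []]" for l w k
      unfolding half using False by (intro less) (simp add: half[symmetric])
    have sum: "binary (a + b + of_bool c)
        = (if odd ?d then One else Zero) # binary ((a + b + of_bool c) div 2)"
      using False by (subst binary_rec) auto
    define da where "da = (if a = 0 then [] else [if odd a then One else Zero])"
    define db where "db = (if b = 0 then [] else [if odd b then One else Zero])"
    have a: "binary a = da @ binary (a div 2)" and b: "binary b = db @ binary (b div 2)"
      unfolding da_def db_def by (rule binary_rec)+
    \<comment> \<open>Digits plus carry decrease in each round: a carry arises from none only when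
      both numbers lose a digit, and if no digits are left, the carry disappears.\<close>
    have time: "2 * (length (binary (a div 2)) + length (binary (b div 2)) + of_bool ?c) + 1 + 2
        \<le> 2 * (length (binary a) + length (binary b) + of_bool c) + 1"
      unfolding a b using False by (auto simp: da_def db_def)
    let ?ts = "[tape l (binary b @ Comma # r), tape w [], tape k (binary a),
      tape [] (if c then [One] else [])]"
    have action: "map2 act (add_digits (map scanned ?ts)) ?ts =
       [tape (rev db @ l) (binary (b div 2) @ Comma # r),
        tape ((if odd ?d then One else Zero) # w) [],
        tape (map (\<lambda>_. Blank) da @ k) (binary (a div 2)), tape [] (if ?c then [One] else [])]"
      unfolding a b da_def db_def add_digits_def by simp
    have result: "replicate (length (binary (a div 2))) Blank @ map (\<lambda>_. Blank) da @ k
        = replicate (length (binary a)) Blank @ k"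
      unfolding a by (simp add: da_def replicate_append_same)
    show ?thesis
      unfolding adder_def
    proof (rule runs_While_Act[OF _ _ time])
      show "map scanned ?ts ! 0 \<noteq> Comma \<or> map scanned ?ts ! 2 \<noteq> Blank \<or> map scanned ?ts ! 3 \<noteq> Blank"
        using False by (auto simp: a b da_def db_def)
    next
      show "runs (While (\<lambda>rs. rs ! 0 \<noteq> Comma \<or> rs ! 2 \<noteq> Blank \<or> rs ! 3 \<noteq> Blank) (Act add_digits))
        (map2 act (add_digits (map scanned ?ts)) ?ts)
        (2 * (length (binary (a div 2)) + length (binary (b div 2)) + of_bool ?c) + 1)
        [tape (rev (binary b) @ l) (Comma # r), tape (rev (binary (a + b + of_bool c)) @ w) [],
         tape (replicate (length (binary a)) Blank @ k) [], tape [] []]"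
        using IH[where l = "rev db @ l" and w = "(if odd ?d then One else Zero) # w"
            and k = "map (\<lambda>_. Blank) da @ k"]
        unfolding action unfolding sum b result adder_def by (simp only: rev.simps rev_append append_assoc append.simps)
    qed
  qed
qed

lemma runs_back_to_Slash:
  assumes "Slash \<notin> set (x # xs)"
  shows "runs
    (While (\<lambda>rs. rs ! 0 \<noteq> Slash)
       (Act (\<lambda>rs. [(rs ! 0, Move_Left), (rs ! 1, Stay), (rs ! 2, Stay), (rs ! 3, Stay)])))
    [tape (xs @ Slash # l) (x # r), t1, t2, t3] (2 * length xs + 3)
    [tape l (Slash # rev xs @ x # r), t1, t2, t3]"
  using assms
proof (induction xs arbitrary: x r)
  case Nil
  then show ?case
    by - (rule runs_While_Act[where k = 1], auto simp: runs_While_stop)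
next
  case (Cons y xs)
  then show ?case
    by - (rule runs_While_Act[where k = "2 * length xs + 3"], auto)
qed

lemma runs_copy_to_Comma:
  assumes "Comma \<notin> set xs"
  shows "runs
    (While (\<lambda>rs. rs ! 0 \<noteq> Comma)
       (Act (\<lambda>rs. [(rs ! 0, Move_Right), (rs ! 0, Move_Right), (rs ! 2, Stay), (rs ! 3, Stay)])))
    [tape l (xs @ Comma # r), tape w [], t2, t3] (2 * length xs + 1)
    [tape (rev xs @ l) (Comma # r), tape (rev xs @ w) [], t2, t3]"
  using assms
proof (induction xs arbitrary: l w)
  case Nil
  then show ?case by (simp add: runs_While_stop)
next
  case (Cons x xs)
  then show ?case
    by - (rule runs_While_Act[where k = "2 * length xs + 1"], auto)
qed

section \<open>Entries, rows and whole instances\<close>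

text \<open>Tape 2 is not moved back afterwards. The erased digits leave blanks before the head, and
  the nearest one is the guard cell for the next entry.\<close>

lemma runs_entry_prog:
  "runs entry_prog
     [tape l (binary a @ Slash # binary b @ Comma # r), tape w [], tape (Blank # k) [], tape [] []]
     (10 * (length (binary a) + length (binary b) + 2))
     [tape (Comma # rev (binary b) @ Slash # rev (binary a) @ l) r,
      tape (Comma # rev (binary b) @ Slash # rev (binary (a + b)) @ w) [],
      tape (Blank # replicate (length (binary a)) Blank @ k) [], tape [] []]"
  unfolding entry_prog_def
  by (rule runs_conv, rule runs_Seq, rule runs_read_numerator, simp,
      rule runs_Seq, rule runs_Act, simp,
      rule runs_Seq, rule runs_rewind_from_end, simp,
      rule runs_Seq, rule runs_Act, simp,
      rule runs_Seq, rule runs_adder[where c = False, simplified],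
      rule runs_Seq, rule runs_emit,
      rule runs_Seq, rule runs_back_to_Slash, simp,
      rule runs_Seq, rule runs_Act, simp,
      rule runs_Seq, rule runs_copy_to_Comma, simp,
      rule runs_Act, simp, simp add: replicate_app_Cons_same, simp)

text \<open>If p and q are coprime, so are p + q and q; hence \<open>quotient_of\<close> keeps the
  denominator.\<close>

lemma encode_rat_plus_1:
  assumes "x \<ge> 0"
  obtains a b where "encode_rat x = binary a @ Slash # binary b"
    and "encode_rat (x + 1) = binary (a + b) @ Slash # binary b"
proof -
  obtain p q where pq: "quotient_of x = (p, q)" by fastforce
  then have "q > 0" "coprime p q" "x = Fract p q"
    using quotient_of_denom_pos quotient_of_coprime Fract_quotient_of[of x] by auto
  then have "p \<ge> 0" using assms by (simp add: zero_le_Fract_iff)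
  have "x + 1 = Fract (p + q) q"
    using \<open>q > 0\<close> \<open>x = Fract p q\<close> by (simp add: One_rat_def add_rat)
  then have "quotient_of (x + 1) = (p + q, q)"
    using \<open>q > 0\<close> \<open>coprime p q\<close> by (simp add: quotient_of_Fract Rat.normalize_def)
  then show thesis
    using that[of "nat p" "nat q"] pq \<open>p \<ge> 0\<close> \<open>q > 0\<close>
    by (simp add: encode_rat_def nat_add_distrib)
qed

text \<open>An entry starts with a digit or, if its value is 0, with the slash; so it never starts
  with a symbol that ends the loops over entries and rows.\<close>

lemma scanned_numerator: "scanned (tape l (binary a @ Slash # r)) \<in> {Zero, One, Slash}"
  using set_binary[of a] by (cases "binary a") auto

abbreviation encode_row :: "rat list \<Rightarrow> symbol list" where
  "encode_row row \<equiv> concat (map (\<lambda>x. encode_rat x @ [Comma]) row)"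

text \<open>An entry whose code with its comma has length L takes one test and at most 10 L steps,
  whence the factor 11. The cells \<open>k'\<close> behind the guard cell do not matter.\<close>

lemma runs_entries:
  assumes "\<forall>x\<in>set row. x \<ge> 0"
  shows "\<exists>k'. runs (While (\<lambda>rs. rs ! 0 \<noteq> Semicolon) entry_prog)
    [tape l (encode_row row @ Semicolon # r), tape w [], tape (Blank # k) [], tape [] []]
    (11 * length (encode_row row) + 1)
    [tape (rev (encode_row row) @ l) (Semicolon # r),
     tape (rev (encode_row (map (\<lambda>x. x + 1) row)) @ w) [], tape (Blank # k') [], tape [] []]"
  using assms
proof (induction row arbitrary: l w k)
  case Nil
  then show ?case by (auto intro!: exI[of _ k] runs_While_stop)
next
  case (Cons x row)
  obtain a b where x: "encode_rat x = binary a @ Slash # binary b"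
    "encode_rat (x + 1) = binary (a + b) @ Slash # binary b"
    using Cons.prems encode_rat_plus_1 by auto
  obtain k' where IH: "runs (While (\<lambda>rs. rs ! 0 \<noteq> Semicolon) entry_prog)
    [tape (Comma # rev (binary b) @ Slash # rev (binary a) @ l) (encode_row row @ Semicolon # r),
     tape (Comma # rev (binary b) @ Slash # rev (binary (a + b)) @ w) [],
     tape (Blank # replicate (length (binary a)) Blank @ k) [], tape [] []]
    (11 * length (encode_row row) + 1)
    [tape (rev (encode_row row) @ Comma # rev (binary b) @ Slash # rev (binary a) @ l) (Semicolon # r),
     tape (rev (encode_row (map (\<lambda>x. x + 1) row)) @ Comma # rev (binary b) @ Slash # rev (binary (a + b)) @ w) [],
     tape (Blank # k') [], tape [] []]"
    using Cons.IH Cons.prems by fastforce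
  have "scanned (tape l (binary a @ Slash # binary b @ Comma # encode_row row @ Semicolon # r)) \<noteq> Semicolon"
    using scanned_numerator[of l a "binary b @ Comma # encode_row row @ Semicolon # r"] by auto
  from runs_While_True[OF _ runs_entry_prog IH, THEN runs_mono] this show ?case
    by (intro exI[of _ k']) (simp add: x)
qed

lemma runs_rows:
  assumes "\<forall>row\<in>set V. \<forall>x\<in>set row. x \<ge> 0"
  shows "\<exists>ts. runs (While (\<lambda>rs. rs ! 0 \<noteq> Blank) row_prog)
    [tape l (concat (map (\<lambda>row. encode_row row @ [Semicolon]) V)), tape w [], tape (Blank # k) [], tape [] []]
    (11 * length (concat (map (\<lambda>row. encode_row row @ [Semicolon]) V)) + 1) ts \<and>
    ts ! 1 = tape (rev (concat (map (\<lambda>row. encode_row (map (\<lambda>x. x + 1) row @ [0]) @ [Semicolon]) V)) @ w) []"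
  using assms
proof (induction V arbitrary: l w k)
  case Nil
  then show ?case by (auto intro!: exI runs_While_stop)
next
  case (Cons row V)
  have zero: "encode_rat 0 = [Slash, One]"
    by (simp add: encode_rat_def binary.simps)
  obtain k' where row: "runs (While (\<lambda>rs. rs ! 0 \<noteq> Semicolon) entry_prog)
    [tape l (encode_row row @ Semicolon # concat (map (\<lambda>row. encode_row row @ [Semicolon]) V)),
     tape w [], tape (Blank # k) [], tape [] []]
    (11 * length (encode_row row) + 1)
    [tape (rev (encode_row row) @ l) (Semicolon # concat (map (\<lambda>row. encode_row row @ [Semicolon]) V)),
     tape (rev (encode_row (map (\<lambda>x. x + 1) row)) @ w) [], tape (Blank # k') [], tape [] []]"
    using runs_entries[of row] Cons.prems by fastforce
  obtain ts where rows: "runs (While (\<lambda>rs. rs ! 0 \<noteq> Blank) row_prog)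
    [tape (Semicolon # rev (encode_row row) @ l) (concat (map (\<lambda>row. encode_row row @ [Semicolon]) V)),
     tape (Semicolon # Comma # One # Slash # rev (encode_row (map (\<lambda>x. x + 1) row)) @ w) [],
     tape (Blank # k') [], tape [] []]
    (11 * length (concat (map (\<lambda>row. encode_row row @ [Semicolon]) V)) + 1) ts"
    and ts: "ts ! 1 = tape (rev (concat (map (\<lambda>row. encode_row (map (\<lambda>x. x + 1) row @ [0]) @ [Semicolon]) V))
       @ Semicolon # Comma # One # Slash # rev (encode_row (map (\<lambda>x. x + 1) row)) @ w) []"
    using Cons.IH[where k = k'] Cons.prems by (meson list.set_intros(2))
  \<comment> \<open>Even an empty row begins with a semicolon, so the loop over the rows does not
    stop early.\<close>
  have first: "scanned (tape l (encode_row row @ Semicolon # r)) \<noteq> Blank" for l r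
  proof (cases row)
    case row: (Cons x xs)
    have "x \<ge> 0" using Cons.prems row by simp
    then obtain a b where "encode_rat x = binary a @ Slash # binary b"
      by (rule encode_rat_plus_1)
    then show ?thesis
      using scanned_numerator[of l a "binary b @ Comma # encode_row xs @ Semicolon # r"] row by auto
  qed simp
  have "runs row_prog
    [tape l (encode_row row @ Semicolon # concat (map (\<lambda>row. encode_row row @ [Semicolon]) V)),
     tape w [], tape (Blank # k) [], tape [] []]
    (11 * length (encode_row row) + 5)
    [tape (Semicolon # rev (encode_row row) @ l) (concat (map (\<lambda>row. encode_row row @ [Semicolon]) V)),
     tape (Semicolon # Comma # One # Slash # rev (encode_row (map (\<lambda>x. x + 1) row)) @ w) [],
     tape (Blank # k') [], tape [] []]"
    unfolding row_prog_def
    by (rule runs_conv, rule runs_Seq, rule row, rule runs_Seq, rule runs_emit, rule runs_Seq,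
        rule runs_emit, rule runs_Seq, rule runs_emit, rule runs_Act, simp, simp, simp)
  from runs_While_True[OF _ this rows] first[of l]
  have "runs (While (\<lambda>rs. rs ! 0 \<noteq> Blank) row_prog)
    [tape l (concat (map (\<lambda>row. encode_row row @ [Semicolon]) (row # V))),
     tape w [], tape (Blank # k) [], tape [] []]
    (1 + (11 * length (encode_row row) + 5)
       + (11 * length (concat (map (\<lambda>row. encode_row row @ [Semicolon]) V)) + 1)) ts"
    by simp
  \<comment> \<open>The semicolon adds 11 to the bound, which pays for the six steps of the row
    beyond those proportional to its entries.\<close>
  then have "runs (While (\<lambda>rs. rs ! 0 \<noteq> Blank) row_prog)
    [tape l (concat (map (\<lambda>row. encode_row row @ [Semicolon]) (row # V))),
     tape w [], tape (Blank # k) [], tape [] []]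
    (11 * length (concat (map (\<lambda>row. encode_row row @ [Semicolon]) (row # V))) + 1) ts"
    by (rule runs_mono) simp
  with ts show ?case by (auto simp: zero)
qed

lemma runs_copy_header:
  "runs
    (While (\<lambda>rs. rs ! 0 = One)
       (Act (\<lambda>rs. [(rs ! 0, Move_Right), (One, Move_Right), (One, Move_Right), (rs ! 3, Stay)])))
    [tape l (replicate m One @ Semicolon # r), tape w [], tape k [], t3] (2 * m + 1)
    [tape (replicate m One @ l) (Semicolon # r), tape (replicate m One @ w) [],
     tape (replicate m One @ k) [], t3]"
proof (induction m arbitrary: l w k)
  case 0
  then show ?case by (simp add: runs_While_stop)
next
  case (Suc m)
  from Suc[of "One # l" "One # w" "One # k"] show ?case
    by - (rule runs_While_Act[where k = "2 * m + 1"], auto simp: replicate_app_Cons_same)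
qed

text \<open>Each \<open>One\<close> on tape 2 stands for a house and yields a zero entry; they are
  erased from the right until the guard cell is reached. The first left move is again part of the
  statement, which covers \<open>m = 0\<close>.\<close>

lemma runs_new_agent:
  "runs
    (While (\<lambda>rs. rs ! 2 = One)
       (emit Slash ;; emit One ;;
        Act (\<lambda>rs. [(rs ! 0, Stay), (Comma, Move_Right), (Blank, Move_Left), (rs ! 3, Stay)])))
    [t0, tape w [], act (Blank, Move_Left) (tape (replicate m One @ [Blank]) []), t3] (4 * m + 1)
    [t0, tape (rev (concat (replicate m [Slash, One, Comma])) @ w) [], tape [] [], t3]"
proof (induction m arbitrary: w)
  case 0
  then show ?case by (simp add: runs_While_stop)
next
  case (Suc m)
  have app: "rev (concat (replicate m [Slash, One, Comma])) @ Comma # One # Slash # w =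
    Comma # One # Slash # rev (concat (replicate m [Slash, One, Comma])) @ w"
    by (induction m) auto
  \<comment> \<open>The symbol under the head is overwritten by a blank in any case, so the tape has
    the form required by the induction hypothesis.\<close>
  have erase: "act (Blank, Move_Left) (tape (replicate m One @ [Blank]) [One])
      = act (Blank, Move_Left) (tape (replicate m One @ [Blank]) [])"
    by (cases m) auto
  show ?case
    by (rule runs_conv, rule runs_While_True, simp, rule runs_Seq, simp, rule runs_emit, rule runs_Seq,
        rule runs_emit, rule runs_Act, simp add: erase, rule Suc) (simp_all add: app)
qed

definition extend_instance :: "instance_data \<Rightarrow> instance_data" where
  "extend_instance I =
     (Suc (fst I), (replicate (fst I) 0 @ [1]) # map (\<lambda>row. map (\<lambda>x. x + 1) row @ [0]) (snd I))"

lemma runs_instance_prog: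
  assumes "I \<in> weighted_instances"
  shows "\<exists>ts. runs instance_prog [tape [] (encode_instance I), tape [] [], tape [] [], tape [] []]
      (11 * length (encode_instance I) + 20) ts \<and>
    ts ! 1 = tape (rev (encode_instance (extend_instance I))) []"
proof -
  obtain m V where I: "I = (m, V)" by fastforce
  let ?rows = "concat (map (\<lambda>row. encode_row row @ [Semicolon]) V)"
  \<comment> \<open>The reverse of what is written before the old rows: the header for
    \<open>Suc m\<close> houses and the row of the new agent.\<close>
  let ?w = "Semicolon # Comma # One # Slash # One # rev (concat (replicate m [Slash, One, Comma])) @
      Semicolon # One # replicate m One"
  obtain ts where rows: "runs (While (\<lambda>rs. rs ! 0 \<noteq> Blank) row_prog)
    [tape (Semicolon # replicate m One) ?rows, tape ?w [], tape [Blank] [], tape [] []] (11 * length ?rows + 1) ts"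
    and ts: "ts ! 1 = tape (rev (concat (map (\<lambda>row. encode_row (map (\<lambda>x. x + 1) row @ [0]) @ [Semicolon]) V)) @ ?w) []"
    using runs_rows[of V] assms by (fastforce simp: I weighted_instances_def)
  have "runs instance_prog [tape [] (replicate m One @ Semicolon # ?rows), tape [] [], tape [] [], tape [] []]
      (11 * (m + 1 + length ?rows) + 20) ts"
    unfolding instance_prog_def
    by (rule runs_conv, rule runs_Seq, rule runs_Act, simp, rule runs_Seq, rule runs_copy_header,
        rule runs_Seq, rule runs_emit, rule runs_Seq, rule runs_Act, simp, rule runs_Seq,
        rule runs_new_agent, rule runs_Seq, rule runs_emit, rule runs_Seq, rule runs_emit,
        rule runs_Seq, rule runs_emit, rule runs_Seq, rule runs_emit, rule runs_Seq, rule runs_Act,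
        simp, rule rows) simp_all
  moreover have "encode_rat 0 = [Slash, One]" "encode_rat 1 = [One, Slash, One]"
    by (simp_all add: encode_rat_def binary.simps)
  ultimately show ?thesis
    using ts by (auto simp: I encode_instance_def extend_instance_def map_replicate_const o_def replicate_append_same)
qed

section \<open>Correctness of the reduction\<close>

locale extension =
  fixes m n :: nat and v v' :: "nat \<Rightarrow> nat \<Rightarrow> real"
  assumes nonneg: "i < n \<Longrightarrow> h < m \<Longrightarrow> v i h \<ge> 0"
    and new_agent: "h < m \<Longrightarrow> v' 0 h = 0" "v' 0 m = 1"
    and old_agent: "i < n \<Longrightarrow> h < m \<Longrightarrow> v' (Suc i) h = v i h + 1" "i < n \<Longrightarrow> v' (Suc i) m = 0"
begin

abbreviation alloc :: "(nat \<rightharpoonup> nat) \<Rightarrow> bool" where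
  "alloc \<equiv> allocation {..<Suc n} {..<Suc m}"

definition positive :: "(nat \<rightharpoonup> nat) \<Rightarrow> nat set" where
  "positive B = {i \<in> {..<Suc n}. utility v' i (B i) > 0}"

text \<open>These turn out to be both the allocations in which \<open>Suc (min m n)\<close> agents
  have positive value and the egalitarian welfare maximizing ones.\<close>

definition good :: "(nat \<rightharpoonup> nat) \<Rightarrow> bool" where
  "good B \<longleftrightarrow> alloc B \<and> B 0 = Some m \<and> complete_allocation {..<n} {..<m} (B \<circ> Suc)"

lemma allocD:
  assumes "alloc B" "B i = Some h"
  shows "i \<le> n" "h \<le> m" "B j = Some h \<Longrightarrow> j = i"
  using assms by (auto simp: allocation_def ran_def dom_def inj_on_def less_Suc_eq_le subset_iff)

text \<open>Positive values are 1 for the new agent and shifted by 1 for the old ones, so none lies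
  below 1. Old agents value the new house at 0, and the new agent values the old houses at
  0.\<close>

lemma positiveD:
  assumes "alloc B" "i \<in> positive B"
  shows "utility v' i (B i) \<ge> 1" "i \<in> dom B" "B i = Some m \<longleftrightarrow> i = 0"
proof -
  obtain h where h: "B i = Some h" and pos: "v' i h > 0"
    using assms(2) by (auto simp: positive_def utility_def split: option.splits)
  have "v' i h \<ge> 1 \<and> (h = m \<longleftrightarrow> i = 0)"
  proof (cases i)
    case 0
    with pos allocD(2)[OF assms(1) h] show ?thesis
      using new_agent by (cases "h = m") auto
  next
    case (Suc j)
    with pos allocD[OF assms(1) h] show ?thesis
      using old_agent[of j] nonneg[of j] by (cases "h = m") auto
  qed
  with h show "utility v' i (B i) \<ge> 1" "i \<in> dom B" "B i = Some m \<longleftrightarrow> i = 0"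
    by (auto simp: utility_def)
qed

lemma utility_new_agent_le_1: "alloc B \<Longrightarrow> utility v' 0 (B 0) \<le> 1"
  using positiveD(3)[of B 0] new_agent(2)
  by (cases "utility v' 0 (B 0) > 0") (auto simp: positive_def utility_def)

lemma card_dom:
  assumes "allocation N H A"
  shows "card (dom A) = card (ran A)"
proof -
  have "ran A = (\<lambda>i. the (A i)) ` dom A" by (force simp: ran_def)
  moreover have "inj_on (\<lambda>i. the (A i)) (dom A)"
    using assms by (auto simp: allocation_def inj_on_def dom_def)
  ultimately show ?thesis by (simp add: card_image)
qed

lemma
  assumes "alloc B"
  shows finite_dom: "finite (dom B)" and card_dom_le: "card (dom B) \<le> Suc (min m n)"
proof -
  have "dom B \<subseteq> {..<Suc n}" "ran B \<subseteq> {..<Suc m}" using assms by (auto simp: allocation_def)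
  then show "finite (dom B)" "card (dom B) \<le> Suc (min m n)"
    using card_mono[of "{..<Suc n}" "dom B"] card_mono[of "{..<Suc m}" "ran B"] card_dom[OF assms]
    by (auto intro: finite_subset)
qed

lemma finite_positive: "finite (positive B)"
  by (simp add: positive_def)

lemma card_positive_le:
  assumes "alloc B"
  shows "card (positive B) \<le> Suc (min m n)"
  using card_mono[OF finite_dom[OF assms], of "positive B"] positiveD(2)[OF assms]
    card_dom_le[OF assms] by (auto simp: subset_iff)

lemma card_dom_complete:
  assumes "complete_allocation {..<n} {..<m} A"
  shows "card (dom A) = min m n"
  using assms card_dom[of "{..<n}" "{..<m}" A] by (auto simp: complete_allocation_def split: if_splits)

lemma positive_good:
  assumes "good B"
  shows "positive B = dom B" "card (positive B) = Suc (min m n)"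
proof -
  have B: "alloc B" "B 0 = Some m" "complete_allocation {..<n} {..<m} (B \<circ> Suc)"
    using assms by (auto simp: good_def)
  show eq: "positive B = dom B"
  proof
    show "positive B \<subseteq> dom B" using positiveD(2)[OF B(1)] by auto
    show "dom B \<subseteq> positive B"
    proof
      fix i assume "i \<in> dom B"
      then obtain h where h: "B i = Some h" by auto
      show "i \<in> positive B"
      proof (cases i)
        case 0
        with B(2) new_agent(2) show ?thesis by (simp add: positive_def utility_def)
      next
        case (Suc j)
        then have "h \<noteq> m" using allocD(3)[OF B(1) h, of 0] B(2) by auto
        with Suc have "h < m" "j < n" using allocD(1,2)[OF B(1) h] by auto
        with Suc h old_agent(1) nonneg[of j h] show ?thesis
          by (auto simp: positive_def utility_def)
      qed
    qed
  qed
  have "dom B = insert 0 (Suc ` dom (B \<circ> Suc))"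
  proof (intro set_eqI)
    fix i show "i \<in> dom B \<longleftrightarrow> i \<in> insert 0 (Suc ` dom (B \<circ> Suc))"
      using B(2) by (cases i) (auto simp: image_iff)
  qed
  moreover have "finite (dom (B \<circ> Suc))"
    using B(3) by (auto simp: complete_allocation_def allocation_def intro: finite_subset)
  ultimately show "card (positive B) = Suc (min m n)"
    using card_dom_complete[OF B(3)] by (simp add: eq card_image)
qed

text \<open>Cardinalities leave no slack: every assigned agent is positive, and all agents (if
  \<open>n \<le> m\<close>) or all houses (otherwise) are assigned. Thus agent 0 is positive or
  house \<open>m\<close> is assigned, and either way agent 0 holds house \<open>m\<close>.\<close>

lemma good_if_card_positive:
  assumes B: "alloc B" and card: "card (positive B) \<ge> Suc (min m n)"
  shows "good B"
proof -
  have eq: "positive B = dom B"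
    using card_seteq[OF finite_dom[OF B], of "positive B"] positiveD(2)[OF B] card card_dom_le[OF B]
    by auto
  have 0: "B 0 = Some m" and complete: "if n \<le> m then dom (B \<circ> Suc) = {..<n} else {..<m} \<subseteq> ran (B \<circ> Suc)"
  proof -
    have "B 0 = Some m \<and> (if n \<le> m then dom (B \<circ> Suc) = {..<n} else {..<m} \<subseteq> ran (B \<circ> Suc))"
    proof (cases "n \<le> m")
      case True
      then have "dom B = {..<Suc n}"
        using card_seteq[of "{..<Suc n}" "positive B"] card eq
        by (auto simp: positive_def)
      moreover from this have "B 0 = Some m"
        using positiveD(3)[OF B, of 0] eq by auto
      ultimately show ?thesis using True by (auto simp: set_eq_iff dom_def)
    next
      case False
      have ran: "ran B = {..<Suc m}"
        using card_seteq[of "{..<Suc m}" "ran B"] card eq card_dom[OF B] B False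
        by (auto simp: allocation_def)
      then have "m \<in> ran B" by simp
      then obtain i where "B i = Some m" by (auto simp: ran_def)
      then have 0: "B 0 = Some m" using positiveD(3)[OF B, of i] eq by auto
      have "h \<in> ran (B \<circ> Suc)" if h: "h < m" for h
      proof -
        from h ran have "h \<in> ran B" by simp
        then obtain i where "B i = Some h" by (auto simp: ran_def)
        with 0 h show ?thesis by (cases i) (auto simp: ran_def)
      qed
      with False 0 show ?thesis by auto
    qed
    then show "B 0 = Some m" "if n \<le> m then dom (B \<circ> Suc) = {..<n} else {..<m} \<subseteq> ran (B \<circ> Suc)"
      by auto
  qed
  have "allocation {..<n} {..<m} (B \<circ> Suc)"
    unfolding allocation_def
  proof (intro conjI)
    show "dom (B \<circ> Suc) \<subseteq> {..<n}" using allocD(1)[OF B] by fastforce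
    have "h < m" if h: "B (Suc i) = Some h" for i h
      using allocD(2)[OF B h] allocD(3)[OF B h, of 0] 0 by (cases "h = m") auto
    then show "ran (B \<circ> Suc) \<subseteq> {..<m}" by (auto simp: ran_def)
    show "inj_on (B \<circ> Suc) (dom (B \<circ> Suc))"
      using allocD(3)[OF B] by (fastforce simp: inj_on_def)
  qed
  with B 0 complete show ?thesis
    by (auto simp: good_def complete_allocation_def allocation_def split: if_splits)
qed

text \<open>On good allocations, this extension is the inverse of the restriction
  \<open>B \<circ> Suc\<close>.\<close>

lemma good_case_nat:
  assumes "complete_allocation {..<n} {..<m} A"
  shows "good (case_nat (Some m) A)"
proof -
  have A: "allocation {..<n} {..<m} A" using assms by (simp add: complete_allocation_def)
  then have A': "i < n" "h < m" if "A i = Some h" for i h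
    using that by (auto simp: allocation_def dom_def ran_def)
  have "alloc (case_nat (Some m) A)"
    unfolding allocation_def
  proof (intro conjI inj_onI)
    show "dom (case_nat (Some m) A) \<subseteq> {..<Suc n}"
      using A'(1) by (auto split: nat.splits)
    show "ran (case_nat (Some m) A) \<subseteq> {..<Suc m}"
    proof
      fix h assume "h \<in> ran (case_nat (Some m) A)"
      then obtain i where "case_nat (Some m) A i = Some h" by (auto simp: ran_def)
      with A'(2) show "h \<in> {..<Suc m}" by (cases i) (auto simp: less_Suc_eq)
    qed
    fix i j
    assume ij: "i \<in> dom (case_nat (Some m) A)" "j \<in> dom (case_nat (Some m) A)"
      "case_nat (Some m) A i = case_nat (Some m) A j"
    have "A i' = A j' \<Longrightarrow> A j' = Some h \<Longrightarrow> i' = j'" for i' j' h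
      using A by (auto simp: allocation_def inj_on_def dom_def)
    with ij A'(2) show "i = j" by (cases i; cases j) fastforce+
  qed
  with assms show ?thesis by (simp add: good_def o_def)
qed

text \<open>Supplies the competitor that forces every maximizer to have positive egalitarian
  welfare.\<close>

lemma good_exists: "\<exists>B. good B"
proof -
  let ?A = "\<lambda>i. if i < min m n then Some i else None"
  have "complete_allocation {..<n} {..<m} ?A"
    by (auto simp: complete_allocation_def allocation_def ran_def dom_def inj_on_def split: if_splits)
  then show ?thesis using good_case_nat by blast
qed

section \<open>Egalitarian welfare in the extended instance\<close>

lemma egal_value_pos_iff:
  assumes "finite S" "S \<noteq> {}" "S \<subseteq> {..<Suc n}"
  shows "egal_value v' S B > 0 \<longleftrightarrow> S \<subseteq> positive B"
  using assms by (auto simp: egal_value_def positive_def)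

lemma egal_value_good:
  assumes "good B"
  shows "egal_value v' (positive B) B \<ge> 1"
proof -
  have "positive B \<noteq> {}" using positive_good(2)[OF assms] by auto
  with assms positiveD(1)[of B] show ?thesis
    by (auto simp: egal_value_def finite_positive good_def)
qed

text \<open>Either \<open>T\<close> contains an agent without positive value, or \<open>T\<close> is
  all of \<open>positive B\<close> by cardinality. In the latter case \<open>B\<close> is good, so
  \<open>T\<close> contains agent 0, whose utility is at most 1.\<close>

lemma egal_value_le_1:
  assumes B: "alloc B" and T: "T \<subseteq> {..<Suc n}" "card T = Suc (min m n)"
  shows "egal_value v' T B \<le> 1"
proof -
  have fin: "finite T" "T \<noteq> {}" using T by (auto intro: finite_subset)
  have "0 \<in> T" if "T \<subseteq> positive B"
  proof -
    have "T = positive B"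
      using card_seteq[OF finite_positive that] card_positive_le[OF B] T(2) by simp
    moreover have "good B" using good_if_card_positive[OF B] \<open>T = positive B\<close> T(2) by simp
    ultimately show ?thesis using positive_good(1) by (auto simp: good_def)
  qed
  then consider "0 \<in> T" | "\<not> T \<subseteq> positive B" by blast
  then show ?thesis
  proof cases
    case 1
    have "egal_value v' T B \<le> utility v' 0 (B 0)"
      using 1 fin by (auto simp: egal_value_def)
    with utility_new_agent_le_1[OF B] show ?thesis by simp
  next
    case 2
    then have "\<not> egal_value v' T B > 0" using egal_value_pos_iff[OF fin T(1)] by simp
    then show ?thesis by linarith
  qed
qed

lemma max_positive: "max_positive_agents {..<Suc n} {..<Suc m} v' = Suc (min m n)"
  unfolding max_positive_agents_def positive_def[symmetric]
proof (rule Max_eqI)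
  obtain B where "good B" using good_exists by blast
  then show "Suc (min m n) \<in> {card (positive A) |A. alloc A}"
    using positive_good(2)[of B] by (auto simp: good_def intro!: exI[of _ B])
  show "finite {card (positive A) |A. alloc A}"
    using card_positive_le by (auto intro: finite_subset[of _ "{..Suc (min m n)}"])
qed (use card_positive_le in auto)

text \<open>The optimum is 1: good allocations reach it and none exceeds it. A maximizer therefore
  makes \<open>Suc (min m n)\<close> agents positive, which characterizes good allocations. The two
  cases are those of the definition of welfare maximization.\<close>

lemma egal_maximizing_iff_good: "egal_maximizing {..<Suc n} {..<Suc m} v' B \<longleftrightarrow> good B"
proof -
  obtain B0 where B0: "good B0" using good_exists by blast
  have all_positive: "(\<forall>i\<in>{..<Suc n}. utility v' i (C i) > 0) \<longleftrightarrow> positive C = {..<Suc n}" for C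
    unfolding positive_def by blast
  have sub: "positive C \<subseteq> {..<Suc n}" for C
    unfolding positive_def by blast
  have full: "positive C = {..<Suc n} \<longleftrightarrow> card (positive C) = Suc n" for C
    using card_subset_eq[OF finite_lessThan sub, of C] by (metis card_lessThan)
  \<comment> \<open>Thanks to the new agent the required number of positive agents is not 0, so the
    unspecified minimum of the empty set never enters.\<close>
  have nonempty: "S \<noteq> {}" "finite S" if "S \<subseteq> {..<Suc n}" "card S = Suc (min m n)" for S
    using that finite_subset[OF that(1) finite_lessThan] by auto
  show ?thesis
  proof (cases "n \<le> m")
    case True
    then have "\<exists>C. alloc C \<and> (\<forall>i\<in>{..<Suc n}. utility v' i (C i) > 0)"
      using B0 positive_good(2)[OF B0] unfolding all_positive full by (auto simp: good_def)
    then have iff: "egal_maximizing {..<Suc n} {..<Suc m} v' B \<longleftrightarrow>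
      alloc B \<and> (\<forall>C. alloc C \<longrightarrow> egal_value v' {..<Suc n} C \<le> egal_value v' {..<Suc n} B)"
      unfolding egal_maximizing_def by (simp only: if_True)
    have good_full: "positive C = {..<Suc n}" if "good C" for C
      using positive_good(2)[OF that] True by (simp add: full)
    show ?thesis
    proof
      assume max: "egal_maximizing {..<Suc n} {..<Suc m} v' B"
      have "egal_value v' {..<Suc n} B0 \<le> egal_value v' {..<Suc n} B"
        using max B0 by (simp add: iff good_def)
      then have "1 \<le> egal_value v' {..<Suc n} B"
        using egal_value_good[OF B0] unfolding good_full[OF B0] by simp
      then have "{..<Suc n} \<subseteq> positive B"
        using egal_value_pos_iff[of "{..<Suc n}" B] by auto
      then have "positive B = {..<Suc n}" by (auto simp: positive_def)
      then show "good B"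
        using max True by (intro good_if_card_positive) (auto simp: iff)
    next
      assume B: "good B"
      have "egal_value v' {..<Suc n} C \<le> egal_value v' {..<Suc n} B" if "alloc C" for C
      proof -
        have "egal_value v' {..<Suc n} C \<le> 1"
          using that True by (intro egal_value_le_1) auto
        with egal_value_good[OF B] show ?thesis unfolding good_full[OF B] by simp
      qed
      with B show "egal_maximizing {..<Suc n} {..<Suc m} v' B"
        unfolding iff by (simp add: good_def)
    qed
  next
    case False
    have "\<not> (\<exists>C. alloc C \<and> (\<forall>i\<in>{..<Suc n}. utility v' i (C i) > 0))"
    proof
      assume "\<exists>C. alloc C \<and> (\<forall>i\<in>{..<Suc n}. utility v' i (C i) > 0)"
      then obtain C where "alloc C" "card (positive C) = Suc n"
        unfolding all_positive full by blast
      with card_positive_le[of C] False show False by simp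
    qed
    then have iff: "egal_maximizing {..<Suc n} {..<Suc m} v' B \<longleftrightarrow> alloc B \<and>
      (\<exists>S\<subseteq>{..<Suc n}. card S = Suc (min m n) \<and> (\<forall>C T. alloc C \<and> T \<subseteq> {..<Suc n} \<and>
         card T = Suc (min m n) \<longrightarrow> egal_value v' T C \<le> egal_value v' S B))"
      unfolding egal_maximizing_def max_positive Let_def by (subst if_not_P) simp_all
    show ?thesis
    proof
      assume "egal_maximizing {..<Suc n} {..<Suc m} v' B"
      then obtain S where B: "alloc B" and S: "S \<subseteq> {..<Suc n}" "card S = Suc (min m n)"
        and max: "\<forall>C T. alloc C \<and> T \<subseteq> {..<Suc n} \<and> card T = Suc (min m n) \<longrightarrow>
          egal_value v' T C \<le> egal_value v' S B"
        unfolding iff by (elim conjE exE) (rule that)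
      have "alloc B0" using B0 by (simp add: good_def)
      then have "1 \<le> egal_value v' S B"
        using egal_value_good[OF B0] max[rule_format, of B0 "positive B0"] sub positive_good(2)[OF B0]
        by simp
      then have "S \<subseteq> positive B"
        using egal_value_pos_iff[OF nonempty(2,1)[OF S] S(1), of B] by simp
      then show "good B"
        using card_mono[OF finite_positive, of S B] S(2) by (intro good_if_card_positive[OF B]) simp
    next
      assume B: "good B"
      have "egal_value v' T C \<le> egal_value v' (positive B) B"
        if "alloc C \<and> T \<subseteq> {..<Suc n} \<and> card T = Suc (min m n)" for C T
        using egal_value_good[OF B] egal_value_le_1[of C T] that by simp
      moreover have "alloc B" using B by (simp add: good_def)
      ultimately show "egal_maximizing {..<Suc n} {..<Suc m} v' B"
        unfolding iff using sub[of B] positive_good(2)[OF B]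
        by (intro conjI exI[of _ "positive B"] allI impI) simp_all
    qed
  qed
qed

section \<open>Total envy in the extended instance\<close>

text \<open>Each of the \<open>n - min m n\<close> agents without a house sees the values of the \<open>min m n\<close> assigned
  houses increased by \<open>1\<close>; all other envies stay the same.\<close>

lemma total_envy_good:
  assumes "good B"
  shows "total_envy {..<Suc n} v' B =
    total_envy {..<n} v (B \<circ> Suc) + real (n - min m n) * real (min m n)"
proof -
  define A where "A = B \<circ> Suc"
  have B: "B 0 = Some m" "\<And>i. B (Suc i) = A i" and A: "complete_allocation {..<n} {..<m} A"
    using assms by (auto simp: good_def A_def)
  have dom: "dom A \<subseteq> {..<n}" and ran: "\<And>i h. A i = Some h \<Longrightarrow> h < m"
    using A by (auto simp: complete_allocation_def allocation_def ran_def)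
  have other_envy: "max (utility v' 0 (A j) - utility v' 0 (Some m)) 0 = 0" for j
    using ran new_agent by (auto simp: utility_def split: option.splits)
  have no_envy: "max (utility v' (Suc i) (Some m) - utility v' (Suc i) (A i)) 0 = 0" if "i < n" for i
    using that ran old_agent nonneg by (fastforce simp: utility_def split: option.splits)
  \<comment> \<open>Between two agents with houses the shifts cancel. Without a house on the side of
    \<open>i\<close> the envied value is nonnegative, so the shift adds exactly 1; without one on
    the side of \<open>j\<close> both envies are 0.\<close>
  have envy: "max (utility v' (Suc i) (A j) - utility v' (Suc i) (A i)) 0 =
      max (utility v i (A j) - utility v i (A i)) 0 + of_bool (i \<notin> dom A) * of_bool (j \<in> dom A)"
    if "i < n" for i j
    using that ran old_agent nonneg by (fastforce simp: utility_def split: option.splits)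
  have "total_envy {..<Suc n} v' B =
      (\<Sum>i<n. \<Sum>j<n. max (utility v' (Suc i) (A j) - utility v' (Suc i) (A i)) 0)"
    unfolding total_envy_def sum.lessThan_Suc_shift B
    using other_envy no_envy by simp
  also have "\<dots> = (\<Sum>i<n. \<Sum>j<n. max (utility v i (A j) - utility v i (A i)) 0)
      + (\<Sum>i<n. \<Sum>j<n. of_bool (i \<notin> dom A) * of_bool (j \<in> dom A))"
    by (simp add: envy sum.distrib)
  also have "(\<Sum>i<n. \<Sum>j<n. of_bool (i \<notin> dom A) * of_bool (j \<in> dom A)) =
      real (card ({..<n} - dom A)) * real (card (dom A))"
  proof -
    have "(\<Sum>i<n. of_bool (i \<notin> dom A)) = real (card ({..<n} - dom A))"
      by (simp add: sum_of_bool_eq Diff_eq Collect_neg_eq)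
    moreover have "(\<Sum>j<n. of_bool (j \<in> dom A)) = real (card (dom A))"
      using dom by (simp add: sum_of_bool_eq Int_absorb1)
    ultimately show ?thesis by (simp only: sum_product[symmetric])
  qed
  also have "card ({..<n} - dom A) = n - min m n"
    using dom card_dom_complete[OF A] by (simp add: card_Diff_subset finite_subset)
  finally show ?thesis
    unfolding card_dom_complete[OF A] by (simp only: total_envy_def A_def)
qed

lemma total_envy_case_nat:
  assumes "complete_allocation {..<n} {..<m} A"
  shows "total_envy {..<Suc n} v' (case_nat (Some m) A) =
    total_envy {..<n} v A + real (n - min m n) * real (min m n)"
  using total_envy_good[OF good_case_nat[OF assms]] by (simp add: o_def)

section \<open>Transfer of minimum envy allocations\<close>

text \<open>This direction shows that the extended instance has a solution whenever the original one
  does.\<close>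

lemma arg_min_case_nat:
  assumes "is_arg_min (total_envy {..<n} v) (complete_allocation {..<n} {..<m}) A"
  shows "is_arg_min (total_envy {..<Suc n} v') (egal_maximizing {..<Suc n} {..<Suc m} v')
    (case_nat (Some m) A)"
  unfolding is_arg_min_linorder egal_maximizing_iff_good
proof (intro conjI allI impI)
  have A: "complete_allocation {..<n} {..<m} A"
    using assms by (simp add: is_arg_min_linorder)
  then show "good (case_nat (Some m) A)" by (rule good_case_nat)
  fix B assume "good B"
  then show "total_envy {..<Suc n} v' (case_nat (Some m) A) \<le> total_envy {..<Suc n} v' B"
    using assms unfolding total_envy_case_nat[OF A] total_envy_good[OF \<open>good B\<close>]
    by (simp add: is_arg_min_linorder good_def)
qed

text \<open>\<open>B\<close> competes with the extensions of all complete allocations, and the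
  constant difference in envy cancels.\<close>

lemma arg_min_comp_Suc:
  assumes "is_arg_min (total_envy {..<Suc n} v') (egal_maximizing {..<Suc n} {..<Suc m} v') B"
  shows "is_arg_min (total_envy {..<n} v) (complete_allocation {..<n} {..<m}) (B \<circ> Suc)"
  unfolding is_arg_min_linorder
proof (intro conjI allI impI)
  have B: "good B" and min: "\<And>C. good C \<Longrightarrow> total_envy {..<Suc n} v' B \<le> total_envy {..<Suc n} v' C"
    using assms by (auto simp: is_arg_min_linorder egal_maximizing_iff_good)
  then show "complete_allocation {..<n} {..<m} (B \<circ> Suc)" by (simp add: good_def)
  fix A assume A: "complete_allocation {..<n} {..<m} A"
  show "total_envy {..<n} v (B \<circ> Suc) \<le> total_envy {..<n} v A"
    using min[OF good_case_nat[OF A]] unfolding total_envy_case_nat[OF A] total_envy_good[OF B] by simp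
qed

end

section \<open>Assembly of the reduction\<close>

lemma extension_extend_instance:
  assumes "I \<in> weighted_instances"
  shows "extension (fst I) (length (snd I)) (valuation I) (valuation (extend_instance I))"
proof -
  have row: "length (snd I ! i) = fst I" "\<And>h. h < fst I \<Longrightarrow> snd I ! i ! h \<ge> 0" if "i < length (snd I)" for i
    using assms nth_mem[OF that] by (auto simp: weighted_instances_def)
  show ?thesis
    by unfold_locales (auto simp: valuation_def extend_instance_def nth_append row of_rat_add)
qed

lemma extend_instance_weighted:
  "I \<in> weighted_instances \<Longrightarrow> extend_instance I \<in> weighted_instances"
  by (fastforce simp: weighted_instances_def extend_instance_def)

lemma set_encode_instance: "Sep \<notin> set (encode_instance I)" "Blank \<notin> set (encode_instance I)"
  by (auto simp: encode_instance_def encode_rat_def)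

text \<open>This is why dropping the first entry of the code computes the restriction to the old
  agents.\<close>

lemma encode_allocation_Suc:
  assumes "length (snd J) = Suc (length (snd I))"
  shows "encode_allocation J A = binary (case A 0 of None \<Rightarrow> 0 | Some h \<Rightarrow> Suc h) @
    Comma # encode_allocation I (A \<circ> Suc)"
  using assms by (simp add: encode_allocation_def upt_conv_Cons map_Suc_upt[symmetric] o_def del: upt_Suc)

lemma polytime_instance:
  "polytime weighted_instances encode_instance (\<lambda>I. encode_instance (extend_instance I))"
proof (rule polytimeI[of 4 instance_prog _ _ "[:20, 11:]"])
  show "well_formed 4 instance_prog"
    by (simp add: instance_prog_def row_prog_def entry_prog_def adder_def add_digits_def emit_def Let_def)
  fix I assume "I \<in> weighted_instances"
  then show "\<exists>ts. runs instance_prog (tape [] (encode_instance I) # replicate (4 - 1) (tape [] []))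
      (poly [:20, 11:] (length (encode_instance I))) ts \<and>
    ts ! 1 = tape (rev (encode_instance (extend_instance I))) []"
    using runs_instance_prog[of I] by (simp add: numeral_eq_Suc algebra_simps)
qed simp

lemma polytime_allocation:
  "polytime D (\<lambda>(I, A). encode_instance I @ [Sep] @ encode_allocation (extend_instance I) A)
    (\<lambda>(I, A). encode_allocation I (A \<circ> Suc))"
proof (rule polytimeI[of 2 allocation_prog _ _ "[:5, 2:]"])
  show "well_formed 2 allocation_prog" by (simp add: allocation_prog_def skip_past_def)
  fix x assume "x \<in> D"
  obtain I A where x: "x = (I, A)" by fastforce
  let ?first = "binary (case A 0 of None \<Rightarrow> 0 | Some h \<Rightarrow> Suc h)"
  have enc: "encode_allocation (extend_instance I) A = ?first @ Comma # encode_allocation I (A \<circ> Suc)"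
    by (rule encode_allocation_Suc) (simp add: extend_instance_def)
  have "Blank \<notin> set (encode_allocation I (A \<circ> Suc))"
    by (auto simp: encode_allocation_def)
  note run = runs_allocation_prog[OF set_encode_instance(1)[of I] notin_binary(3) this,
      of "case A 0 of None \<Rightarrow> 0 | Some h \<Rightarrow> Suc h"]
  show "\<exists>ts. runs allocation_prog
      (tape [] ((\<lambda>(I, A). encode_instance I @ [Sep] @ encode_allocation (extend_instance I) A) x)
        # replicate (2 - 1) (tape [] []))
      (poly [:5, 2:] (length ((\<lambda>(I, A). encode_instance I @ [Sep] @ encode_allocation (extend_instance I) A) x))) ts \<and>
    ts ! 1 = tape (rev ((\<lambda>(I, A). encode_allocation I (A \<circ> Suc)) x)) []"
    unfolding x split enc
    using run
    by (intro exI[of _ "[tape (rev (encode_instance I @ Sep # ?first @ Comma # encode_allocation I (A \<circ> Suc))) [],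
          tape (rev (encode_allocation I (A \<circ> Suc))) []]"])
      (simp add: algebra_simps)
qed simp

theorem theorem5p4:
  shows "poly_reducible min_envy_complete min_envy_egal_maximizing"
  unfolding poly_reducible_def
proof (intro exI[of _ extend_instance] exI[of _ "\<lambda>_ A. A \<circ> Suc"] conjI ballI impI)
  have simps: "agents (extend_instance I) = {..<Suc (length (snd I))}"
    "houses (extend_instance I) = {..<Suc (fst I)}" for I
    by (auto simp: agents_def houses_def extend_instance_def)
  fix I assume I: "I \<in> inputs min_envy_complete"
  then interpret extension "fst I" "length (snd I)" "valuation I" "valuation (extend_instance I)"
    by (intro extension_extend_instance) (simp add: min_envy_complete_def)
  show "extend_instance I \<in> inputs min_envy_egal_maximizing"
    using I extend_instance_weighted by (simp add: min_envy_complete_def min_envy_egal_maximizing_def)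
  show "solutions min_envy_egal_maximizing (extend_instance I) \<noteq> {}"
    if "solutions min_envy_complete I \<noteq> {}"
    using that arg_min_case_nat
    by (auto simp: min_envy_complete_def min_envy_egal_maximizing_def simps agents_def[of I] houses_def[of I])
  show "A \<circ> Suc \<in> solutions min_envy_complete I"
    if "A \<in> solutions min_envy_egal_maximizing (extend_instance I)" for A
    using that arg_min_comp_Suc
    by (auto simp: min_envy_complete_def min_envy_egal_maximizing_def simps agents_def[of I] houses_def[of I])
next
  show "polytime (inputs min_envy_complete) (encode_input min_envy_complete)
      (\<lambda>I. encode_input min_envy_egal_maximizing (extend_instance I))"
    using polytime_instance by (simp add: min_envy_complete_def min_envy_egal_maximizing_def)
  show "polytime {(I, A). I \<in> inputs min_envy_complete \<and>
        A \<in> solutions min_envy_egal_maximizing (extend_instance I)}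
      (\<lambda>(I, A). encode_input min_envy_complete I @ [Sep] @
        encode_solution min_envy_egal_maximizing (extend_instance I) A)
      (\<lambda>(I, A). encode_solution min_envy_complete I (A \<circ> Suc))"
    using polytime_allocation by (simp add: min_envy_complete_def min_envy_egal_maximizing_def)
qed

end
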